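(* Let $a,b,c,d,t,u,v$ be non-negative integers such that $2\le v\le u-1$ and $0\le t\le u-1$. Suppose there exists a $(v+1)$-RGDD of type $u^{v+1}$. Suppose also that there exist 4-GDDs of types $a^u d^1$ and $b^u d^1$, as well as a 4-GDD of type $a^v b^1 c^1$ if $tc>0$, and a 4-GDD of type $a^v b^1$ if $c=0$ or $t<u-1$. Then there exists a 4-GDD of type $(va+b)^u(ct+d)^1$.
   Context: For a positive integer $k$, a $k$-GDD of type $g_1^{u_1}\cdots g_r^{u_r}$ is a triple $(V,\mathcal G,\mathcal B)$ where $V$ is a set of $u_1g_1+\cdots+u_rg_r$ points, $\mathcal G$ is a partition of $V$ into $u_i$ groups of size $g_i$ for each $i$, and $\mathcal B$ is a non-empty collection of $k$-element subsets of $V$ (blocks) such that every pair of points from distinct groups lies in exactly one block and no pair of points from the same group lies in any block. A group size $0$ in a type contributes no group (e.g. type $a^u0^1$ means type $a^u$). A parallel class is a set of blocks partitioning $V$; a $k$-RGDD is a $k$-GDD whose blocks can be partitioned into parallel classes. *)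

theory Defs
  imports Main "HOL-Library.Multiset"
begin

definition is_GDD :: "nat \<Rightarrow> 'a set \<Rightarrow> 'a set set \<Rightarrow> 'a set set \<Rightarrow> bool" where
  "is_GDD k V G B \<longleftrightarrow>
     finite V \<and>
     (\<forall>g\<in>G. g \<noteq> {}) \<and> \<Union>G = V \<and>
     (\<forall>g1\<in>G. \<forall>g2\<in>G. g1 \<noteq> g2 \<longrightarrow> g1 \<inter> g2 = {}) \<and>
     B \<noteq> {} \<and>
     (\<forall>b\<in>B. b \<subseteq> V \<and> card b = k) \<and>
     (\<forall>x\<in>V. \<forall>y\<in>V. (\<exists>g\<in>G. x \<in> g \<and> y \<notin> g) \<longrightarrow> (\<exists>!b. b \<in> B \<and> x \<in> b \<and> y \<in> b)) \<and>
     (\<forall>g\<in>G. \<forall>x\<in>g. \<forall>y\<in>g. x \<noteq> y \<longrightarrow> \<not> (\<exists>b\<in>B. x \<in> b \<and> y \<in> b))"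

definition gdd_type :: "'a set set \<Rightarrow> nat multiset" where
  "gdd_type G = image_mset card (mset_set G)"

text \<open>Types are given as multisets of group sizes; groups of size 0 contribute nothing.\<close>
definition type_norm :: "nat multiset \<Rightarrow> nat multiset" where
  "type_norm T = filter_mset (\<lambda>g. g > 0) T"

definition GDD_exists :: "nat \<Rightarrow> nat multiset \<Rightarrow> bool" where
  "GDD_exists k T \<longleftrightarrow>
     (\<exists>(V::nat set) G B. is_GDD k V G B \<and> gdd_type G = type_norm T)"

definition parallel_class :: "'a set \<Rightarrow> 'a set set \<Rightarrow> bool" where
  "parallel_class V C \<longleftrightarrow> \<Union>C = V \<and> (\<forall>b1\<in>C. \<forall>b2\<in>C. b1 \<noteq> b2 \<longrightarrow> b1 \<inter> b2 = {})"

definition is_RGDD :: "nat \<Rightarrow> 'a set \<Rightarrow> 'a set set \<Rightarrow> 'a set set \<Rightarrow> bool" where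
  "is_RGDD k V G B \<longleftrightarrow> is_GDD k V G B \<and>
     (\<exists>P. \<Union>P = B \<and> (\<forall>C\<in>P. C \<noteq> {} \<and> parallel_class V C) \<and>
          (\<forall>C1\<in>P. \<forall>C2\<in>P. C1 \<noteq> C2 \<longrightarrow> C1 \<inter> C2 = {}))"

definition RGDD_exists :: "nat \<Rightarrow> nat multiset \<Rightarrow> bool" where
  "RGDD_exists k T \<longleftrightarrow>
     (\<exists>(V::nat set) G B. is_RGDD k V G B \<and> gdd_type G = type_norm T)"

end

theory Submission
  imports Defs
begin

text \<open>
  The blocks of one parallel class \<open>C0\<close> of the RGDD become the \<open>u\<close> new groups, after one of the
  \<open>v + 1\<close> old groups gets weight \<open>b\<close> on each of its points and all the others weight \<open>a\<close>. The RGDD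
  is a transversal design, so it has exactly \<open>u - 1\<close> other classes; \<open>t\<close> of them receive an infinite
  point of weight \<open>c\<close>, which is added to every block of the class. A further infinite point of
  weight \<open>d\<close> is added to every old group. The extended blocks outside \<open>C0\<close> together with the
  extended old groups then cover every pair of points from distinct new groups exactly once, and
  each of them is transversal to the new groups, so Wilson's fundamental construction applies with
  the four given 4-GDDs as ingredients.
\<close>

section \<open>GDDs described by a labelling of the points\<close>

text \<open>
  The groups are the nonempty fibres of \<open>lab\<close> on \<open>V\<close>. Labels may have empty fibres, so groups of
  size zero need no separate treatment.
\<close>

definition labelled_GDD :: "nat \<Rightarrow> 'a set \<Rightarrow> ('a \<Rightarrow> 'i) \<Rightarrow> 'a set set \<Rightarrow> bool" where
  "labelled_GDD k V lab B \<longleftrightarrow>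
     finite V \<and> (\<forall>b\<in>B. b \<subseteq> V \<and> card b = k) \<and>
     (\<forall>x\<in>V. \<forall>y\<in>V. lab x \<noteq> lab y \<longrightarrow> (\<exists>!b. b \<in> B \<and> x \<in> b \<and> y \<in> b)) \<and>
     (\<forall>x\<in>V. \<forall>y\<in>V. lab x = lab y \<and> x \<noteq> y \<longrightarrow> \<not> (\<exists>b\<in>B. x \<in> b \<and> y \<in> b))"

text \<open>Only labels that occur on \<open>V\<close> are counted, so for finite \<open>V\<close>
  no entry is zero: the result is already normalised and can be compared directly with a
  \<open>type_norm\<close>.\<close>

definition fibre_type :: "'a set \<Rightarrow> ('a \<Rightarrow> 'i) \<Rightarrow> nat multiset" where
  "fibre_type V lab = image_mset (\<lambda>i. card {x \<in> V. lab x = i}) (mset_set (lab ` V))"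

lemma labelled_GDD_finite: "labelled_GDD k V lab B \<Longrightarrow> finite V"
  by (simp add: labelled_GDD_def)

lemma labelled_GDD_block: "labelled_GDD k V lab B \<Longrightarrow> b \<in> B \<Longrightarrow> b \<subseteq> V \<and> card b = k"
  by (simp add: labelled_GDD_def)

lemma labelled_GDD_distinct:
  assumes "labelled_GDD k V lab B" "x \<in> V" "y \<in> V" "lab x \<noteq> lab y"
  shows "\<exists>!b. b \<in> B \<and> x \<in> b \<and> y \<in> b"
proof -
  have "\<forall>x\<in>V. \<forall>y\<in>V. lab x \<noteq> lab y \<longrightarrow> (\<exists>!b. b \<in> B \<and> x \<in> b \<and> y \<in> b)"
    using assms(1) unfolding labelled_GDD_def by (elim conjE)
  from this[rule_format, OF assms(2-4)] show ?thesis .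
qed

lemma labelled_GDD_same:
  assumes "labelled_GDD k V lab B" "x \<in> V" "y \<in> V" "lab x = lab y" "x \<noteq> y"
    and "b \<in> B" "x \<in> b"
  shows "y \<notin> b"
proof -
  have "\<forall>x\<in>V. \<forall>y\<in>V. lab x = lab y \<and> x \<noteq> y \<longrightarrow> \<not> (\<exists>b\<in>B. x \<in> b \<and> y \<in> b)"
    using assms(1) unfolding labelled_GDD_def by (elim conjE)
  then show ?thesis using assms(2-) by blast
qed

lemma GDD_exists_cong_norm:
  "type_norm S = type_norm T \<Longrightarrow> GDD_exists k S \<longleftrightarrow> GDD_exists k T"
  by (simp add: GDD_exists_def)

lemma type_norm_fibres:
  assumes "finite V" "finite I" "lab ` V \<subseteq> I"
  shows "type_norm (image_mset (\<lambda>i. card {x \<in> V. lab x = i}) (mset_set I)) = fibre_type V lab"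
proof -
  have "0 < card {x \<in> V. lab x = i} \<longleftrightarrow> i \<in> lab ` V" for i
    using assms(1) by (auto simp: card_gt_0_iff)
  then have "{i \<in> I. 0 < card {x \<in> V. lab x = i}} = lab ` V"
    using assms(3) by blast
  then show ?thesis
    unfolding type_norm_def fibre_type_def
    by (simp add: filter_mset_image_mset filter_mset_mset_set assms)
qed

section \<open>Matching equal types and transport along bijections\<close>

text \<open>Induction on \<open>A\<close>: the value of a new element occurs in the multiset of
  \<open>B\<close>, so some element of \<open>B\<close> with that value can be split off. It is used
  to pair the groups of two GDDs of equal type by size.\<close>

lemma image_mset_eq_imp_bij_betw:
  assumes "finite A" "finite B" "image_mset f (mset_set A) = image_mset g (mset_set B)"
  shows "\<exists>\<sigma>. bij_betw \<sigma> A B \<and> (\<forall>x\<in>A. g (\<sigma> x) = f x)"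
  using assms
proof (induction A arbitrary: B rule: finite_induct)
  case empty
  then show ?case by (auto simp: bij_betw_def mset_set_empty_iff)
next
  case (insert a A)
  have eq: "add_mset (f a) (image_mset f (mset_set A)) = image_mset g (mset_set B)"
    using insert by simp
  then have "f a \<in># image_mset g (mset_set B)" by (metis union_single_eq_member)
  then obtain b where b: "b \<in> B" "g b = f a" using insert.prems by auto
  have "mset_set B = add_mset b (mset_set (B - {b}))"
    using b insert.prems by (simp add: mset_set.remove)
  then have "image_mset f (mset_set A) = image_mset g (mset_set (B - {b}))"
    using eq b by simp
  then obtain \<sigma> where \<sigma>: "bij_betw \<sigma> A (B - {b})" "\<forall>x\<in>A. g (\<sigma> x) = f x"
    using insert.IH insert.prems by blast
  have "bij_betw (\<sigma>(a := b)) A (B - {b})"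
    using \<sigma>(1) insert.hyps by (subst bij_betw_cong[of A _ \<sigma>]) auto
  then have "bij_betw (\<sigma>(a := b)) (A \<union> {a}) ((B - {b}) \<union> {b})"
    by (rule bij_betw_combine) (auto simp: bij_betw_def)
  moreover have "A \<union> {a} = insert a A" "(B - {b}) \<union> {b} = B" using b by auto
  ultimately have "bij_betw (\<sigma>(a := b)) (insert a A) B" by simp
  moreover have "\<forall>x\<in>insert a A. g ((\<sigma>(a := b)) x) = f x" using \<sigma> b by auto
  ultimately show ?case by blast
qed

text \<open>Only the equivalence relation induced by the labelling matters, so the labels on the two
  sides may even have different types.\<close>

lemma labelled_GDD_transfer:
  assumes gdd: "labelled_GDD k V lab B" and f: "bij_betw f V W"
    and lab: "\<And>x y. x \<in> V \<Longrightarrow> y \<in> V \<Longrightarrow> lab' (f x) = lab' (f y) \<longleftrightarrow> lab x = lab y"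
  shows "labelled_GDD k W lab' ((`) f ` B)"
proof -
  have inj: "inj_on f V" and W: "W = f ` V" using f by (auto simp: bij_betw_def)
  have sub: "b \<subseteq> V" if "b \<in> B" for b using labelled_GDD_block[OF gdd] that by auto
  have mem: "f x \<in> f ` b \<longleftrightarrow> x \<in> b" if "b \<in> B" "x \<in> V" for b x
    using inj sub that by (meson inj_on_image_mem_iff)
  show ?thesis unfolding labelled_GDD_def
  proof (intro conjI ballI impI)
    show "finite W" using labelled_GDD_finite[OF gdd] W by simp
  next
    fix c assume "c \<in> (`) f ` B"
    then obtain b where "b \<in> B" "c = f ` b" by blast
    then show "c \<subseteq> W" "card c = k"
      using labelled_GDD_block[OF gdd] W inj by (auto simp: card_image inj_on_subset)
  next
    fix x' y' assume "x' \<in> W" "y' \<in> W" and ne: "lab' x' \<noteq> lab' y'"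
    then obtain x y where x: "x \<in> V" "x' = f x" and y: "y \<in> V" "y' = f y" using W by blast
    have "\<exists>!b. b \<in> B \<and> x \<in> b \<and> y \<in> b"
      using labelled_GDD_distinct[OF gdd] x y lab ne by metis
    then obtain b where b: "b \<in> B" "x \<in> b" "y \<in> b"
      and un: "\<And>b'. b' \<in> B \<Longrightarrow> x \<in> b' \<Longrightarrow> y \<in> b' \<Longrightarrow> b' = b" by metis
    show "\<exists>!b. b \<in> (`) f ` B \<and> x' \<in> b \<and> y' \<in> b"
    proof (rule ex1I[of _ "f ` b"])
      show "f ` b \<in> (`) f ` B \<and> x' \<in> f ` b \<and> y' \<in> f ` b" using b x y by blast
    next
      fix c assume "c \<in> (`) f ` B \<and> x' \<in> c \<and> y' \<in> c"
      then obtain b' where b': "b' \<in> B" "c = f ` b'" "x' \<in> f ` b'" "y' \<in> f ` b'" by blast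
      then have "x \<in> b'" "y \<in> b'" using mem[OF b'(1)] x y by simp_all
      then have "b' = b" by (rule un[OF b'(1)])
      then show "c = f ` b" using b' by simp
    qed
  next
    fix x' y' assume "x' \<in> W" "y' \<in> W" and eq: "lab' x' = lab' y' \<and> x' \<noteq> y'"
    then obtain x y where x: "x \<in> V" "x' = f x" and y: "y \<in> V" "y' = f y" using W by blast
    have "y \<notin> b" if "b \<in> B" "x \<in> b" for b
      using labelled_GDD_same[OF gdd, of x y b] that x y lab eq by blast
    then show "\<not> (\<exists>b\<in>(`) f ` B. x' \<in> b \<and> y' \<in> b)" using mem x y by auto
  qed
qed

lemma labelled_GDD_relabel:
  assumes "labelled_GDD k V lab B"
    and "\<And>x y. x \<in> V \<Longrightarrow> y \<in> V \<Longrightarrow> lab' x = lab' y \<longleftrightarrow> lab x = lab y"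
  shows "labelled_GDD k V lab' B"
  using labelled_GDD_transfer[of k V lab B id V lab'] assms by simp

section \<open>Passing between partitions into groups and labellings\<close>

lemma is_GDD_finite: "is_GDD k V G B \<Longrightarrow> finite V"
  and is_GDD_Union: "is_GDD k V G B \<Longrightarrow> \<Union>G = V"
  and is_GDD_blocks_nonempty: "is_GDD k V G B \<Longrightarrow> B \<noteq> {}"
  and is_GDD_block: "is_GDD k V G B \<Longrightarrow> \<forall>b\<in>B. b \<subseteq> V \<and> card b = k"
  and is_GDD_disjoint:
    "is_GDD k V G B \<Longrightarrow> \<forall>g1\<in>G. \<forall>g2\<in>G. g1 \<noteq> g2 \<longrightarrow> g1 \<inter> g2 = {}"
  and is_GDD_same_group: "is_GDD k V G B \<Longrightarrow>
    \<forall>g\<in>G. \<forall>x\<in>g. \<forall>y\<in>g. x \<noteq> y \<longrightarrow> \<not> (\<exists>b\<in>B. x \<in> b \<and> y \<in> b)"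
  unfolding is_GDD_def by (elim conjE, assumption)+

lemma is_GDD_distinct_groups:
  assumes "is_GDD k V G B" "x \<in> V" "y \<in> V" "g \<in> G" "x \<in> g" "y \<notin> g"
  shows "\<exists>!b. b \<in> B \<and> x \<in> b \<and> y \<in> b"
proof -
  have "\<forall>x\<in>V. \<forall>y\<in>V. (\<exists>g\<in>G. x \<in> g \<and> y \<notin> g) \<longrightarrow> (\<exists>!b. b \<in> B \<and> x \<in> b \<and> y \<in> b)"
    using assms(1) unfolding is_GDD_def by (elim conjE)
  from this[rule_format, OF assms(2,3)] show ?thesis using assms(4-6) by blast
qed

lemma is_GDD_group_unique:
  "is_GDD k V G B \<Longrightarrow> g1 \<in> G \<Longrightarrow> g2 \<in> G \<Longrightarrow> x \<in> g1 \<Longrightarrow> x \<in> g2 \<Longrightarrow> g1 = g2"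
  using is_GDD_disjoint by (metis disjoint_iff)

text \<open>The groups partition \<open>V\<close>, so the label of each point is the singleton of
  its own group; taking the set avoids choosing the group.\<close>

lemma is_GDD_imp_labelled_GDD:
  assumes "is_GDD k V G B"
  shows "labelled_GDD k V (\<lambda>x. {g \<in> G. x \<in> g}) B"
proof -
  have dist: "\<exists>g\<in>G. x \<in> g \<and> y \<notin> g"
    if xy: "x \<in> V" "y \<in> V" "{g \<in> G. x \<in> g} \<noteq> {g \<in> G. y \<in> g}" for x y
  proof (rule ccontr)
    assume n: "\<not> (\<exists>g\<in>G. x \<in> g \<and> y \<notin> g)"
    obtain g where g: "g \<in> G" "x \<in> g" using is_GDD_Union[OF assms] xy(1) by blast
    have "g1 = g" if "g1 \<in> G" "x \<in> g1 \<or> y \<in> g1" for g1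
      using is_GDD_group_unique[OF assms] n g that by metis
    then have "{g \<in> G. x \<in> g} = {g}" "{g \<in> G. y \<in> g} = {g}" using g n by blast+
    then show False using xy by simp
  qed
  have same: "\<exists>g\<in>G. x \<in> g \<and> y \<in> g"
    if "x \<in> V" "{g \<in> G. x \<in> g} = {g \<in> G. y \<in> g}" for x y
    using is_GDD_Union[OF assms] that by blast
  show ?thesis unfolding labelled_GDD_def
  proof (intro conjI ballI impI)
    fix x y assume "x \<in> V" "y \<in> V" "{g \<in> G. x \<in> g} \<noteq> {g \<in> G. y \<in> g}"
    then show "\<exists>!b. b \<in> B \<and> x \<in> b \<and> y \<in> b"
      using dist[of x y] is_GDD_distinct_groups[OF assms, of x y] by blast
  next
    fix x y assume "x \<in> V" "y \<in> V" "{g \<in> G. x \<in> g} = {g \<in> G. y \<in> g} \<and> x \<noteq> y"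
    then show "\<not> (\<exists>b\<in>B. x \<in> b \<and> y \<in> b)"
      using same[of x y] is_GDD_same_group[OF assms] by meson
  qed (use is_GDD_finite[OF assms] is_GDD_block[OF assms] in auto)
qed

text \<open>Realises an abstract GDD on a prescribed point set with prescribed groups, as needed to
  place an ingredient on a weighted line. Fibres and groups of equal size are matched, and the
  bijections between matched pairs are glued together. Non-emptiness of the block set is stated
  apart because \<open>labelled_GDD\<close> does not include it.\<close>

lemma GDD_exists_imp_labelled_GDD:
  assumes ex: "GDD_exists k T" and fin: "finite V" and T: "fibre_type V lab = type_norm T"
  shows "\<exists>B. B \<noteq> {} \<and> labelled_GDD k V lab B"
proof -
  obtain W :: "nat set" and G B where gdd: "is_GDD k W G B" and "gdd_type G = type_norm T"
    using ex by (auto simp: GDD_exists_def)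
  then have ty: "image_mset (\<lambda>i. card {x \<in> V. lab x = i}) (mset_set (lab ` V)) =
      image_mset card (mset_set G)"
    using T by (simp add: gdd_type_def fibre_type_def)
  note W = is_GDD_Union[OF gdd] and finW = is_GDD_finite[OF gdd]
    and disj = is_GDD_group_unique[OF gdd]
  have "finite G" using W finW by (simp add: finite_UnionD)
  then obtain \<sigma> where \<sigma>: "bij_betw \<sigma> (lab ` V) G"
    and "\<forall>i\<in>lab ` V. card (\<sigma> i) = card {x \<in> V. lab x = i}"
    using image_mset_eq_imp_bij_betw[OF _ _ ty] fin by auto
  moreover have "finite (\<sigma> i)" if "i \<in> lab ` V" for i
    using \<sigma> W finW that by (metis Sup_upper bij_betwE finite_subset)
  ultimately have "\<forall>i\<in>lab ` V. \<exists>h. bij_betw h (\<sigma> i) {x \<in> V. lab x = i}"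
    using fin by (intro ballI finite_same_card_bij) auto
  then obtain h where h: "\<And>i. i \<in> lab ` V \<Longrightarrow> bij_betw (h i) (\<sigma> i) {x \<in> V. lab x = i}"
    by metis
  \<comment> \<open>\<open>\<tau> y\<close> is the label whose matched group contains
    \<open>y\<close>; it selects which of the bijections \<open>h i\<close> acts on
    \<open>y\<close>.\<close>
  define \<tau> where "\<tau> y = (THE i. i \<in> lab ` V \<and> y \<in> \<sigma> i)" for y
  have \<sigma>G: "\<sigma> i \<in> G" if "i \<in> lab ` V" for i using \<sigma> that by (auto simp: bij_betw_def)
  have \<sigma>un: "i = j" if "i \<in> lab ` V" "j \<in> lab ` V" "y \<in> \<sigma> i" "y \<in> \<sigma> j" for i j y
    using that disj[OF \<sigma>G \<sigma>G] \<sigma> by (meson bij_betw_def inj_on_contraD)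
  have \<tau>eq: "\<tau> y = i" if "i \<in> lab ` V" "y \<in> \<sigma> i" for i y
    unfolding \<tau>_def using that \<sigma>un by (intro the_equality) auto
  have \<tau>: "\<tau> y \<in> lab ` V" "y \<in> \<sigma> (\<tau> y)" if "y \<in> W" for y
  proof -
    obtain g where "g \<in> G" "y \<in> g" using W \<open>y \<in> W\<close> by auto
    then obtain i where "i \<in> lab ` V" "y \<in> \<sigma> i" using \<sigma> by (auto simp: bij_betw_def)
    then show "\<tau> y \<in> lab ` V" "y \<in> \<sigma> (\<tau> y)" using \<tau>eq by auto
  qed
  define \<phi> where "\<phi> y = h (\<tau> y) y" for y
  have \<phi>: "\<phi> y \<in> V" "lab (\<phi> y) = \<tau> y" if "y \<in> W" for y
    using h[OF \<tau>(1)[OF that]] \<tau>(2)[OF that] unfolding \<phi>_def bij_betw_def by auto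
  have "bij_betw \<phi> W V" unfolding bij_betw_def
  proof (intro conjI inj_onI equalityI subsetI)
    fix x y assume xy: "x \<in> W" "y \<in> W" "\<phi> x = \<phi> y"
    then have "\<tau> x = \<tau> y" using \<phi>(2) by metis
    moreover have "inj_on (h (\<tau> x)) (\<sigma> (\<tau> x))" using h \<tau> xy by (simp add: bij_betw_def)
    ultimately show "x = y" using xy \<tau>(2) unfolding \<phi>_def by (metis inj_onD)
  next
    fix x assume x: "x \<in> V"
    then have "h (lab x) ` \<sigma> (lab x) = {z \<in> V. lab z = lab x}"
      using h by (simp add: bij_betw_def)
    then obtain y where y: "y \<in> \<sigma> (lab x)" "h (lab x) y = x" using x by force
    then have "\<phi> y = x" using \<tau>eq[of "lab x" y] x unfolding \<phi>_def by simp
    moreover have "y \<in> W" using y \<sigma>G x W by blast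
    ultimately show "x \<in> \<phi> ` W" by blast
  qed (use \<phi> in auto)
  moreover have "lab (\<phi> x) = lab (\<phi> y) \<longleftrightarrow> {g \<in> G. x \<in> g} = {g \<in> G. y \<in> g}"
    if "x \<in> W" "y \<in> W" for x y
  proof -
    have "{g \<in> G. z \<in> g} = {\<sigma> (\<tau> z)}" if "z \<in> W" for z
      using \<tau>[OF that] \<sigma>G disj by blast
    then show ?thesis using that \<phi>(2) \<tau> \<tau>eq by (metis singleton_inject)
  qed
  ultimately have "labelled_GDD k V lab ((`) \<phi> ` B)"
    by (rule labelled_GDD_transfer[OF is_GDD_imp_labelled_GDD[OF gdd]])
  moreover have "B \<noteq> {}" by (rule is_GDD_blocks_nonempty[OF gdd])
  ultimately show ?thesis by (metis image_is_empty)
qed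

lemma labelled_GDD_imp_is_GDD:
  assumes "labelled_GDD k V lab B" "B \<noteq> {}"
  shows "is_GDD k V ((\<lambda>i. {x \<in> V. lab x = i}) ` lab ` V) B"
  unfolding is_GDD_def
proof (intro conjI)
  show "\<forall>x\<in>V. \<forall>y\<in>V. (\<exists>g\<in>(\<lambda>i. {x \<in> V. lab x = i}) ` lab ` V. x \<in> g \<and> y \<notin> g) \<longrightarrow>
      (\<exists>!b. b \<in> B \<and> x \<in> b \<and> y \<in> b)"
  proof (intro ballI impI)
    fix x y assume xy: "x \<in> V" "y \<in> V"
      and "\<exists>g\<in>(\<lambda>i. {x \<in> V. lab x = i}) ` lab ` V. x \<in> g \<and> y \<notin> g"
    then have "lab x \<noteq> lab y" by auto
    then show "\<exists>!b. b \<in> B \<and> x \<in> b \<and> y \<in> b"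
      using labelled_GDD_distinct[OF assms(1)] xy by simp
  qed
  show "\<forall>g\<in>(\<lambda>i. {x \<in> V. lab x = i}) ` lab ` V. \<forall>x\<in>g. \<forall>y\<in>g. x \<noteq> y \<longrightarrow>
      \<not> (\<exists>b\<in>B. x \<in> b \<and> y \<in> b)"
  proof (intro ballI impI)
    fix g x y assume "g \<in> (\<lambda>i. {x \<in> V. lab x = i}) ` lab ` V" "x \<in> g" "y \<in> g" "x \<noteq> y"
    then have "x \<in> V" "y \<in> V" "lab x = lab y" "x \<noteq> y" by auto
    then show "\<not> (\<exists>b\<in>B. x \<in> b \<and> y \<in> b)"
      using labelled_GDD_same[OF assms(1)] by metis
  qed
  show "\<forall>b\<in>B. b \<subseteq> V \<and> card b = k" using labelled_GDD_block[OF assms(1)] by blast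
  show "finite V" by (rule labelled_GDD_finite[OF assms(1)])
qed (use assms(2) in auto)

text \<open>\<open>GDD_exists\<close> asks for natural numbers as points, while constructions
  produce points of other types; an injection of the finite set \<open>V\<close> into the naturals
  bridges the gap.\<close>

lemma labelled_GDD_imp_GDD_exists:
  fixes V :: "'a set"
  assumes gdd: "labelled_GDD k V lab B" and ne: "B \<noteq> {}" and T: "fibre_type V lab = type_norm T"
  shows "GDD_exists k T"
proof -
  have "finite V" by (rule labelled_GDD_finite[OF gdd])
  then obtain f :: "'a \<Rightarrow> nat" where inj: "inj_on f V"
    by (meson finite_imp_inj_to_nat_seg)
  define W where "W = f ` V"
  define m where "m = lab \<circ> inv_into V f"
  define G where "G = (\<lambda>i. {x \<in> W. m x = i}) ` (m ` W)"
  have mf: "m (f x) = lab x" if "x \<in> V" for x using that inj by (simp add: m_def)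
  have L: "labelled_GDD k W m ((`) f ` B)"
    using labelled_GDD_transfer[OF gdd, of f W m] inj mf by (simp add: W_def bij_betw_def)
  have "is_GDD k W G ((`) f ` B)"
    unfolding G_def using L ne by (intro labelled_GDD_imp_is_GDD) auto
  moreover have "gdd_type G = fibre_type V lab"
  proof -
    have mW: "m ` W = lab ` V" using mf by (force simp: W_def)
    have inj2: "inj_on (\<lambda>i. {x \<in> W. m x = i}) (m ` W)" by (auto simp: inj_on_def)
    have "card {x \<in> W. m x = i} = card {x \<in> V. lab x = i}" for i
    proof -
      have "{x \<in> W. m x = i} = f ` {x \<in> V. lab x = i}" using mf by (auto simp: W_def)
      then show ?thesis using inj by (simp add: card_image inj_on_subset)
    qed
    then have "image_mset card (image_mset (\<lambda>i. {x \<in> W. m x = i}) (mset_set (m ` W))) =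
        fibre_type V lab"
      by (simp add: fibre_type_def mW multiset.map_comp comp_def)
    then show ?thesis
      unfolding gdd_type_def G_def by (simp add: image_mset_mset_set[OF inj2])
  qed
  ultimately show ?thesis using T unfolding GDD_exists_def by metis
qed

section \<open>Wilson's fundamental construction\<close>

text \<open>A block through \<open>x\<close> and \<open>y\<close> comes from a piece containing
  both. For distinct labels there is only one such piece, so existence and uniqueness of the block
  are inherited from it.\<close>

lemma labelled_GDD_UN:
  assumes fin: "finite W" and part: "\<And>s. s \<in> S \<Longrightarrow> labelled_GDD k (X s) lab (B s)"
    and sub: "\<And>s. s \<in> S \<Longrightarrow> X s \<subseteq> W"
    and pair: "\<And>x y. x \<in> W \<Longrightarrow> y \<in> W \<Longrightarrow> lab x \<noteq> lab y \<Longrightarrow> \<exists>!s. s \<in> S \<and> x \<in> X s \<and> y \<in> X s"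
  shows "labelled_GDD k W lab (\<Union>s\<in>S. B s)"
  unfolding labelled_GDD_def
proof (intro conjI ballI impI)
  have blk: "b \<subseteq> X s \<and> card b = k" if "s \<in> S" "b \<in> B s" for s b
    using labelled_GDD_block[OF part] that by simp
  {
    fix b assume "b \<in> (\<Union>s\<in>S. B s)"
    then obtain s where "s \<in> S" "b \<in> B s" by blast
    then show "b \<subseteq> W" "card b = k" using blk[of s b] sub[of s] by auto
  next
    fix x y assume xy: "x \<in> W" "y \<in> W" "lab x \<noteq> lab y"
    obtain s where s: "s \<in> S" "x \<in> X s" "y \<in> X s"
      and un: "\<And>r. r \<in> S \<Longrightarrow> x \<in> X r \<Longrightarrow> y \<in> X r \<Longrightarrow> r = s"
      using pair[OF xy] by metis
    have "\<exists>!b. b \<in> B s \<and> x \<in> b \<and> y \<in> b"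
      by (rule labelled_GDD_distinct[OF part]) (use s xy in auto)
    moreover have "b \<in> (\<Union>s\<in>S. B s) \<and> x \<in> b \<and> y \<in> b \<longleftrightarrow> b \<in> B s \<and> x \<in> b \<and> y \<in> b" for b
      using s un blk by (metis UN_iff subsetD)
    ultimately show "\<exists>!b. b \<in> (\<Union>s\<in>S. B s) \<and> x \<in> b \<and> y \<in> b" by presburger
  next
    fix x y assume xy: "lab x = lab y \<and> x \<noteq> y"
    show "\<not> (\<exists>b\<in>(\<Union>s\<in>S. B s). x \<in> b \<and> y \<in> b)"
    proof
      assume "\<exists>b\<in>(\<Union>s\<in>S. B s). x \<in> b \<and> y \<in> b"
      then obtain s b where "s \<in> S" "b \<in> B s" "x \<in> b" "y \<in> b" by blast
      then show False using labelled_GDD_same[OF part[of s], of x y b] blk[of s b] xy by blast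
    qed
  }
qed (rule fin)

text \<open>
  The master design is only a pairwise covering by lines \<open>S\<close> of arbitrary sizes. Weights may be
  zero, in which case the conclusion's type contains zeros that are dropped by normalisation.
\<close>

theorem wilson_fundamental_construction:
  fixes wt :: "'a \<Rightarrow> nat" and lab :: "'a \<Rightarrow> 'i"
  assumes fin: "finite Q" and sub: "\<And>L. L \<in> S \<Longrightarrow> L \<subseteq> Q" and ne: "S \<noteq> {}"
    and pair: "\<And>p q. p \<in> Q \<Longrightarrow> q \<in> Q \<Longrightarrow> lab p \<noteq> lab q \<Longrightarrow> \<exists>!L. L \<in> S \<and> p \<in> L \<and> q \<in> L"
    and inj: "\<And>L. L \<in> S \<Longrightarrow> inj_on lab L"
    and gdd: "\<And>L. L \<in> S \<Longrightarrow> GDD_exists k (image_mset wt (mset_set L))"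
  shows "GDD_exists k (image_mset (\<lambda>i. \<Sum>p | p \<in> Q \<and> lab p = i. wt p) (mset_set (lab ` Q)))"
proof -
  \<comment> \<open>Each point \<open>p\<close> is replaced by \<open>wt p\<close> copies, so points
    of weight zero vanish.\<close>
  define X where "X L = (SIGMA p:L. {..<wt p})" for L
  have finX: "finite (X L)" if "L \<subseteq> Q" for L
    using that fin unfolding X_def by (auto intro: finite_subset)
  have "\<exists>B. B \<noteq> {} \<and> labelled_GDD k (X L) (lab \<circ> fst) B" if L: "L \<in> S" for L
  proof -
    have "{x \<in> X L. fst x = p} = {p} \<times> {..<wt p}" if "p \<in> L" for p
      using that by (auto simp: X_def)
    then have "image_mset (\<lambda>p. card {x \<in> X L. fst x = p}) (mset_set L) =
        image_mset wt (mset_set L)"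
      using finite_subset[OF sub[OF L] fin] by (intro image_mset_cong) auto
    moreover have "fst ` X L \<subseteq> L" by (auto simp: X_def)
    ultimately have "fibre_type (X L) fst = type_norm (image_mset wt (mset_set L))"
      using type_norm_fibres[of "X L" L fst] finX[OF sub[OF L]] finite_subset[OF sub[OF L] fin]
      by simp
    then obtain B where "B \<noteq> {}" "labelled_GDD k (X L) fst B"
      using GDD_exists_imp_labelled_GDD[OF gdd[OF L]] finX[OF sub[OF L]] by blast
    \<comment> \<open>The ingredient on a line has the copies of single points as groups. Since
      \<open>lab\<close> is injective on the line, these are also the traces of the final
      groups.\<close>
    moreover have "(lab \<circ> fst) x = (lab \<circ> fst) y \<longleftrightarrow> fst x = fst y"
      if "x \<in> X L" "y \<in> X L" for x y
      using that inj[OF L] by (auto simp: X_def inj_on_def)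
    ultimately show ?thesis
      using labelled_GDD_relabel[of k "X L" fst B "lab \<circ> fst"] by blast
  qed
  then obtain B where B: "\<And>L. L \<in> S \<Longrightarrow> B L \<noteq> {}"
    "\<And>L. L \<in> S \<Longrightarrow> labelled_GDD k (X L) (lab \<circ> fst) (B L)" by metis
  have blocks: "labelled_GDD k (X Q) (lab \<circ> fst) (\<Union>L\<in>S. B L)"
  proof (rule labelled_GDD_UN[where X = X])
    fix x y assume xy: "x \<in> X Q" "y \<in> X Q" "(lab \<circ> fst) x \<noteq> (lab \<circ> fst) y"
    then have "fst x \<in> Q" "fst y \<in> Q" "lab (fst x) \<noteq> lab (fst y)" by (auto simp: X_def)
    then have "\<exists>!L. L \<in> S \<and> fst x \<in> L \<and> fst y \<in> L" by (rule pair)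
    moreover have "x \<in> X L \<longleftrightarrow> fst x \<in> L" "y \<in> X L \<longleftrightarrow> fst y \<in> L" for L
      using xy by (auto simp: X_def)
    ultimately show "\<exists>!L. L \<in> S \<and> x \<in> X L \<and> y \<in> X L" by simp
  next
    show "X L \<subseteq> X Q" if "L \<in> S" for L using sub[OF that] by (auto simp: X_def)
  qed (simp_all add: finX B)
  have nonempty: "(\<Union>L\<in>S. B L) \<noteq> {}" using ne B(1) by blast
  have "card {x \<in> X Q. (lab \<circ> fst) x = i} = (\<Sum>p | p \<in> Q \<and> lab p = i. wt p)" for i
  proof -
    have "{x \<in> X Q. (lab \<circ> fst) x = i} = (SIGMA p:{p \<in> Q. lab p = i}. {..<wt p})"
      by (auto simp: X_def)
    then show ?thesis using fin by simp
  qed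
  moreover have "(lab \<circ> fst) ` X Q \<subseteq> lab ` Q" by (auto simp: X_def)
  ultimately have "type_norm (image_mset (\<lambda>i. \<Sum>p | p \<in> Q \<and> lab p = i. wt p) (mset_set (lab ` Q)))
      = fibre_type (X Q) (lab \<circ> fst)"
    using type_norm_fibres[of "X Q" "lab ` Q" "lab \<circ> fst"] finX[of Q] fin by simp
  then show ?thesis
    by (intro labelled_GDD_imp_GDD_exists[OF blocks nonempty]) simp
qed

section \<open>Counting in resolvable transversal designs\<close>

lemma uniform_type_groups:
  assumes "gdd_type G = type_norm (replicate_mset n u)" "0 < u" "finite G"
  shows "card G = n" and "\<And>g. g \<in> G \<Longrightarrow> card g = u"
proof -
  have "type_norm (replicate_mset n u) = replicate_mset n u"
    using assms(2) by (induction n) (auto simp: type_norm_def)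
  then have eq: "image_mset card (mset_set G) = replicate_mset n u"
    using assms(1) by (simp add: gdd_type_def)
  then show "card G = n" by (metis size_image_mset size_mset_set size_replicate_mset)
  fix g assume "g \<in> G"
  then have "card g \<in># replicate_mset n u" using assms(3) unfolding eq[symmetric] by simp
  then show "card g = u" by (simp split: if_splits)
qed

text \<open>A block has at most one point in each group and as many points as there are groups, so
  it misses none.\<close>

lemma block_group_transversal:
  assumes gdd: "is_GDD k V G B" and k: "card G = k" and b: "b \<in> B" and g: "g \<in> G"
  shows "\<exists>!x. x \<in> b \<and> x \<in> g"
proof -
  have fin: "finite G" using is_GDD_Union[OF gdd] is_GDD_finite[OF gdd] by (simp add: finite_UnionD)
  have b': "b \<subseteq> V" "card b = k" using is_GDD_block[OF gdd] b by auto
  then have "\<forall>x\<in>b. \<exists>h. h \<in> G \<and> x \<in> h" using is_GDD_Union[OF gdd] by blast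
  then obtain f where f: "\<And>x. x \<in> b \<Longrightarrow> f x \<in> G" "\<And>x. x \<in> b \<Longrightarrow> x \<in> f x" by metis
  have same: "x = y" if "x \<in> b" "y \<in> b" "h \<in> G" "x \<in> h" "y \<in> h" for x y h
    using is_GDD_same_group[OF gdd] b that by metis
  then have "inj_on f b" using f by (metis inj_onI)
  then have "f ` b = G" using f(1) fin k b' by (intro card_subset_eq) (auto simp: card_image)
  then obtain x where "x \<in> b" "x \<in> g" using f g by blast
  then show ?thesis using same[OF _ _ g] by blast
qed

text \<open>The blocks of one class correspond to the points of any fixed group, each block meeting
  it once. For the number of classes, fix a point \<open>x\<close> and a group \<open>g'\<close> not
  containing it: each class has one block through \<open>x\<close>, and each point of
  \<open>g'\<close> lies on one block through \<open>x\<close>.\<close>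

lemma transversal_RGDD_counts:
  assumes gdd: "is_GDD k V G B" and k: "card G = k" "2 \<le> k"
    and u: "\<And>g. g \<in> G \<Longrightarrow> card g = u" "0 < u"
    and P: "\<Union>P = B" "\<And>C. C \<in> P \<Longrightarrow> parallel_class V C"
      "\<forall>C1\<in>P. \<forall>C2\<in>P. C1 \<noteq> C2 \<longrightarrow> C1 \<inter> C2 = {}"
  shows "card P = u" and "\<And>C. C \<in> P \<Longrightarrow> card C = u"
proof -
  define pt where "pt g b = (THE x. x \<in> b \<and> x \<in> g)" for g b :: "'a set"
  have pt: "pt g b \<in> b" "pt g b \<in> g" if "b \<in> B" "g \<in> G" for b g
    using theI'[OF block_group_transversal[OF gdd k(1) that]] by (auto simp: pt_def)
  have pt_eq: "pt g b = x" if "b \<in> B" "g \<in> G" "x \<in> b" "x \<in> g" for b g x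
    unfolding pt_def by (rule the1_equality[OF block_group_transversal[OF gdd k(1)]]) (use that in auto)
  have V: "x \<in> V" if "x \<in> g" "g \<in> G" for x g using is_GDD_Union[OF gdd] that by auto
  have blk: "\<exists>!b. b \<in> C \<and> x \<in> b" if "C \<in> P" "x \<in> V" for C x
    using P(2)[OF that(1)] that(2) unfolding parallel_class_def by blast
  \<comment> \<open>The assumption \<open>2 \<le> k\<close> provides a second group, which the count
    of classes relies on.\<close>
  obtain g g' where g: "g \<in> G" and g': "g' \<in> G" "g \<noteq> g'"
    using k by (metis card_le_Suc0_iff_eq card.infinite not_less_eq_eq numeral_2_eq_2 zero_le)
  show "card C = u" if C: "C \<in> P" for C
  proof -
    have CB: "b \<in> B" if "b \<in> C" for b using P(1) C that by blast
    have "bij_betw (pt g) C g"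
    proof (rule bij_betwI')
      fix b b' assume "b \<in> C" "b' \<in> C"
      then show "pt g b = pt g b' \<longleftrightarrow> b = b'" using blk[OF C V[OF _ g]] pt[OF CB g] by metis
    next
      fix x assume x: "x \<in> g"
      then obtain b where "b \<in> C" "x \<in> b" using blk[OF C V[OF _ g]] by blast
      then show "\<exists>b\<in>C. x = pt g b" using pt_eq[OF CB g _ x] by metis
    qed (rule pt[OF CB g])
    then show ?thesis using u g by (metis bij_betw_same_card)
  qed
  show "card P = u"
  proof -
    obtain x where x: "x \<in> g" using u g by fastforce
    have xg': "x \<notin> g'" using is_GDD_group_unique[OF gdd g g'(1) x] g' by blast
    define S where "S = {b \<in> B. x \<in> b}"
    define bl where "bl C = (THE b. b \<in> C \<and> x \<in> b)" for C
    have bl: "bl C \<in> C" "x \<in> bl C" if "C \<in> P" for C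
      using theI'[OF blk[OF that V[OF x g]]] by (auto simp: bl_def)
    have bl_eq: "bl C = b" if "C \<in> P" "b \<in> C" "x \<in> b" for C b
      unfolding bl_def by (rule the1_equality[OF blk[OF that(1) V[OF x g]]]) (use that in auto)
    have "bij_betw bl P S"
    proof (rule bij_betwI')
      fix C D assume "C \<in> P" "D \<in> P"
      then show "bl C = bl D \<longleftrightarrow> C = D" using bl P(3) by (metis disjoint_iff)
    next
      fix b assume "b \<in> S"
      then obtain C where "C \<in> P" "b \<in> C" "x \<in> b" using P(1) unfolding S_def by blast
      then show "\<exists>C\<in>P. b = bl C" using bl_eq by metis
    next
      fix C assume "C \<in> P"
      then show "bl C \<in> S" using bl[of C] P(1) unfolding S_def by blast
    qed
    moreover have "bij_betw (pt g') S g'"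
    proof (rule bij_betwI')
      have un: "\<exists>!b. b \<in> B \<and> y \<in> b \<and> x \<in> b" if "y \<in> g'" for y
        by (rule is_GDD_distinct_groups[OF gdd V[OF that g'(1)] V[OF x g] g'(1) that xg'])
      have S: "b \<in> B" "x \<in> b" if "b \<in> S" for b using that by (auto simp: S_def)
      {
        fix b b' assume b: "b \<in> S" "b' \<in> S"
        have "b = b'" if "pt g' b = pt g' b'"
          using un[OF pt(2)[OF S(1)[OF b(1)] g'(1)]] pt(1)[OF _ g'(1)] S b that by metis
        then show "pt g' b = pt g' b' \<longleftrightarrow> b = b'" by blast
      next
        fix y assume y: "y \<in> g'"
        then obtain b where b: "b \<in> B" "y \<in> b" "x \<in> b" using un by blast
        then show "\<exists>b\<in>S. y = pt g' b" using pt_eq[OF _ g'(1) _ y, of b] unfolding S_def by blast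
      next
        fix b assume "b \<in> S"
        then show "pt g' b \<in> g'" using pt[OF _ g'(1)] S by blast
      }
    qed
    ultimately show ?thesis using u g' by (metis bij_betw_same_card)
  qed
qed

section \<open>Extending the RGDD and weighting it\<close>

theorem theorem3p3:
  fixes a b c d t u v :: nat
  assumes "2 \<le> v" and "v \<le> u - 1" and "t \<le> u - 1"
    and "RGDD_exists (v + 1) (replicate_mset (v + 1) u)"
    and "GDD_exists 4 (replicate_mset u a + {#d#})"
    and "GDD_exists 4 (replicate_mset u b + {#d#})"
    and "t * c > 0 \<longrightarrow> GDD_exists 4 (replicate_mset v a + {#b#} + {#c#})"
    and "c = 0 \<or> t < u - 1 \<longrightarrow> GDD_exists 4 (replicate_mset v a + {#b#})"
  shows "GDD_exists 4 (replicate_mset u (v * a + b) + {#c * t + d#})"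
proof -
  obtain V :: "nat set" and G B where rgdd: "is_RGDD (v + 1) V G B"
    and type: "gdd_type G = type_norm (replicate_mset (v + 1) u)"
    using assms(4) by (auto simp: RGDD_exists_def)
  have gdd: "is_GDD (v + 1) V G B" using rgdd unfolding is_RGDD_def by (elim conjE)
  obtain P where PB: "\<Union>P = B" and Ppar: "\<forall>C\<in>P. C \<noteq> {} \<and> parallel_class V C"
    and Pdisj: "\<forall>C1\<in>P. \<forall>C2\<in>P. C1 \<noteq> C2 \<longrightarrow> C1 \<inter> C2 = {}"
    using rgdd unfolding is_RGDD_def by (elim conjE exE)
  have u: "0 < u" using assms(1,2) by simp
  have finV: "finite V" and GV: "\<Union>G = V"
    using is_GDD_finite[OF gdd] is_GDD_Union[OF gdd] by auto
  have "finite G" using finV GV by (simp add: finite_UnionD)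
  note groups = uniform_type_groups[OF type u this]
  have blocks: "x \<subseteq> V" "card x = v + 1" if "x \<in> B" for x
    using is_GDD_block[OF gdd] that by auto
  have PBD: "x \<in> B" if "x \<in> C" "C \<in> P" for x C using PB that by blast
  have "2 \<le> v + 1" using assms(1) by simp
  moreover have parallel: "parallel_class V C" if "C \<in> P" for C using Ppar that by simp
  ultimately have cardP: "card P = u" and card_class: "\<And>C. C \<in> P \<Longrightarrow> card C = u"
    using transversal_RGDD_counts[OF gdd groups(1) _ groups(2) u PB _ Pdisj] by simp_all
  have par: "\<exists>!x. x \<in> C \<and> p \<in> x" if "C \<in> P" "p \<in> V" for C p
    using parallel[OF that(1)] that(2) unfolding parallel_class_def by blast
  have grp: "\<exists>!g. g \<in> G \<and> p \<in> g" if "p \<in> V" for p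
    using that GV is_GDD_group_unique[OF gdd] by blast
  have class_unique: "C = D" if "C \<in> P" "D \<in> P" "x \<in> C" "x \<in> D" for C D x
    using Pdisj that by blast
  have same: "p = q" if "p \<in> g" "q \<in> g" "g \<in> G" "p \<in> x" "q \<in> x" "x \<in> B" for p q g x
    using is_GDD_same_group[OF gdd] that by metis
  \<comment> \<open>Two distinct points of a common block lie in different groups, which is what the
    covering axiom requires.\<close>
  have block_unique: "x = y" if "p \<in> x" "q \<in> x" "p \<in> y" "q \<in> y" "p \<noteq> q" "x \<in> B" "y \<in> B" for p q x y
  proof -
    have pq: "p \<in> V" "q \<in> V" using blocks that by blast+
    obtain g where "g \<in> G" "p \<in> g" using grp pq by blast
    then have "\<exists>!b. b \<in> B \<and> p \<in> b \<and> q \<in> b"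
      using same[of p g q x] that by (intro is_GDD_distinct_groups[OF gdd pq]) blast+
    then show ?thesis using that by blast
  qed
  have "P \<noteq> {}" "G \<noteq> {}" using cardP groups(1) u by auto
  then obtain C0 g0 where C0: "C0 \<in> P" and g0: "g0 \<in> G" by blast
  have finP: "finite P" using cardP u by (simp add: card_ge_0_finite)
  \<comment> \<open>There are \<open>u\<close> classes in all, hence \<open>u - 1\<close> besides
    \<open>C0\<close>, enough to choose \<open>t\<close> of them.\<close>
  have "t \<le> card (P - {C0})" using cardP C0 finP assms(3) by simp
  then obtain T where T: "T \<subseteq> P - {C0}" "card T = t" "finite T"
    by (meson obtain_subset_with_card_n)
  have C0B: "x \<in> B" if "x \<in> C0" for x using PBD[OF that C0] .
  \<comment> \<open>The empty set will label the infinite points, so it must differ from every block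
    of \<open>C0\<close>.\<close>
  have empty: "{} \<notin> C0" using C0B blocks(2) by fastforce

  \<comment> \<open>\<open>Inr C\<close> is the infinite point of the class \<open>C\<close>; \<open>Inr C0\<close> is the one of weight \<open>d\<close>, since
    \<open>C0\<close> itself receives none.\<close>
  define w where "w x = (if x \<in> g0 then b else a)" for x
  define wt where "wt = case_sum w (\<lambda>C. if C = C0 then d else c)"
  define lab where "lab = case_sum (\<lambda>x. THE y. y \<in> C0 \<and> x \<in> y) (\<lambda>_::nat set set. {})"
  define Q where "Q = Inl ` V \<union> Inr ` insert C0 T"
  define gl where "gl g = insert (Inr C0) (Inl ` g)" for g :: "nat set"
  \<comment> \<open>The intersection adds the infinite point exactly when \<open>C\<close> is one of
    the chosen classes.\<close>
  define bl where "bl C x = Inl ` x \<union> Inr ` ({C} \<inter> T)" for C and x :: "nat set"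
  define S where "S = gl ` G \<union> {bl C x | C x. C \<in> P - {C0} \<and> x \<in> C}"
  have labR: "lab (Inr C) = {}" for C by (simp add: lab_def)
  have labL: "lab (Inl p) \<in> C0" "p \<in> lab (Inl p)" if "p \<in> V" for p
    using theI'[OF par[OF C0 that]] by (auto simp: lab_def)
  have labeq: "lab (Inl p) = x" if "x \<in> C0" "p \<in> x" for x p
    using par[OF C0, of p] labL[of p] blocks(1)[OF C0B[OF that(1)]] that by blast
  have glI: "gl g \<in> S" if "g \<in> G" for g using that by (auto simp: S_def)
  have blI: "bl C x \<in> S" if "C \<in> P" "C \<noteq> C0" "x \<in> C" for C x using that by (auto simp: S_def)
  have SE: "(\<exists>g\<in>G. L = gl g) \<or> (\<exists>C\<in>P. \<exists>x\<in>C. C \<noteq> C0 \<and> L = bl C x)" if "L \<in> S" for L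
    using that by (auto simp: S_def)
  have mem_gl: "Inl p \<in> gl g \<longleftrightarrow> p \<in> g" "Inr D \<in> gl g \<longleftrightarrow> D = C0" for p g D
    by (auto simp: gl_def)
  have mem_bl: "Inl p \<in> bl C x \<longleftrightarrow> p \<in> x" "Inr D \<in> bl C x \<longleftrightarrow> D = C \<and> D \<in> T" for p C x D
    by (auto simp: bl_def)

  \<comment> \<open>Points of a common old group are joined by its extension, all others by the
    extension of their unique block.\<close>
  have LL: "\<exists>!L. L \<in> S \<and> Inl p \<in> L \<and> Inl q \<in> L"
    if pq: "p \<in> V" "q \<in> V" "lab (Inl p) \<noteq> lab (Inl q)" for p q
  proof -
    have ne: "p \<noteq> q" using pq by blast
    obtain g where g: "g \<in> G" "p \<in> g" using grp[OF pq(1)] by blast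
    show ?thesis
    proof (cases "q \<in> g")
      case True
      show ?thesis
      proof (rule ex1I[of _ "gl g"])
        show "gl g \<in> S \<and> Inl p \<in> gl g \<and> Inl q \<in> gl g" using glI[OF g(1)] mem_gl(1) g(2) True by simp
      next
        fix L assume L: "L \<in> S \<and> Inl p \<in> L \<and> Inl q \<in> L"
        then have "L \<in> S" by simp
        from SE[OF this] show "L = gl g"
        proof (elim disjE bexE conjE)
          fix h assume h: "h \<in> G" "L = gl h"
          then have "p \<in> h" using L mem_gl(1) by simp
          then show ?thesis using is_GDD_group_unique[OF gdd h(1) g(1) _ g(2)] h(2) by simp
        next
          fix C x assume C: "C \<in> P" "x \<in> C" "L = bl C x"
          then have "p \<in> x" "q \<in> x" using L mem_bl(1) by simp_all
          then show ?thesis using same[OF g(2) True g(1) _ _ PBD[OF C(2,1)]] ne by simp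
        qed
      qed
    next
      case False
      then obtain x where x: "x \<in> B" "p \<in> x" "q \<in> x"
        using is_GDD_distinct_groups[OF gdd pq(1,2) g False] by blast
      then obtain C where C: "C \<in> P" "x \<in> C" using PB by blast
      \<comment> \<open>If the block were in \<open>C0\<close>, it would be the label of both
        points.\<close>
      have "C \<noteq> C0" using C x pq labeq by metis
      show ?thesis
      proof (rule ex1I[of _ "bl C x"])
        show "bl C x \<in> S \<and> Inl p \<in> bl C x \<and> Inl q \<in> bl C x"
          using blI[OF C(1) \<open>C \<noteq> C0\<close> C(2)] mem_bl(1) x by simp
      next
        fix L assume L: "L \<in> S \<and> Inl p \<in> L \<and> Inl q \<in> L"
        then have "L \<in> S" by simp
        from SE[OF this] show "L = bl C x"
        proof (elim disjE bexE conjE)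
          fix h assume h: "h \<in> G" "L = gl h"
          then have "p \<in> h" "q \<in> h" using L mem_gl(1) by simp_all
          then show ?thesis using is_GDD_group_unique[OF gdd h(1) g(1) _ g(2)] False by simp
        next
          fix D y assume D: "D \<in> P" "y \<in> D" "L = bl D y"
          then have "p \<in> y" "q \<in> y" using L mem_bl(1) by simp_all
          then have "y = x" using block_unique[OF _ _ x(2,3) ne PBD[OF D(2,1)] x(1)] by simp
          then show ?thesis using class_unique[OF D(1) C(1) D(2)] D(3) C(2) by simp
        qed
      qed
    qed
  qed
  \<comment> \<open>\<open>Inr C0\<close> lies on every extended group, and the unique old group
    through \<open>p\<close> selects one. For \<open>C\<close> in \<open>T\<close>, the unique block
    of \<open>C\<close> through \<open>p\<close> does.\<close>
  have LR: "\<exists>!L. L \<in> S \<and> Inl p \<in> L \<and> Inr C \<in> L" if p: "p \<in> V" and C: "C \<in> insert C0 T" for p C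
  proof (cases "C = C0")
    case True
    obtain g where g: "g \<in> G" "p \<in> g" using grp[OF p] by blast
    show ?thesis
    proof (rule ex1I[of _ "gl g"])
      show "gl g \<in> S \<and> Inl p \<in> gl g \<and> Inr C \<in> gl g" using glI[OF g(1)] mem_gl g(2) True by simp
    next
      fix L assume L: "L \<in> S \<and> Inl p \<in> L \<and> Inr C \<in> L"
      then have "L \<in> S" by simp
      from SE[OF this] show "L = gl g"
      proof (elim disjE bexE conjE)
        fix h assume h: "h \<in> G" "L = gl h"
        then have "p \<in> h" using L mem_gl(1) by simp
        then show ?thesis using is_GDD_group_unique[OF gdd h(1) g(1) _ g(2)] h(2) by simp
      next
        fix D x assume "D \<noteq> C0" "L = bl D x"
        then show ?thesis using mem_bl(2) L True by simp
      qed
    qed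
  next
    case False
    then have CT: "C \<in> T" "C \<in> P" using C T by auto
    obtain x where x: "x \<in> C" "p \<in> x" using par[OF CT(2) p] by blast
    show ?thesis
    proof (rule ex1I[of _ "bl C x"])
      show "bl C x \<in> S \<and> Inl p \<in> bl C x \<and> Inr C \<in> bl C x"
        using blI[OF CT(2) False x(1)] mem_bl x(2) CT(1) by simp
    next
      fix L assume L: "L \<in> S \<and> Inl p \<in> L \<and> Inr C \<in> L"
      then have "L \<in> S" by simp
      from SE[OF this] show "L = bl C x"
      proof (elim disjE bexE conjE)
        fix h assume "L = gl h"
        then show ?thesis using mem_gl(2) L False by simp
      next
        fix D y assume D: "y \<in> D" "L = bl D y"
        then have "D = C" "p \<in> y" using mem_bl L by simp_all
        moreover then have "y = x" using par[OF CT(2) p] D(1) x by blast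
        ultimately show ?thesis using D(2) by simp
      qed
    qed
  qed

  have fin_block: "finite x" if "x \<in> B" for x using blocks(1)[OF that] finV by (rule finite_subset)
  have wtL: "image_mset wt (mset_set (Inl ` X)) = image_mset w (mset_set X)" for X
  proof -
    have "wt \<circ> Inl = w" by (auto simp: wt_def)
    then have "image_mset wt (image_mset Inl (mset_set X)) = image_mset w (mset_set X)"
      by (simp only: multiset.map_comp)
    then show ?thesis by (simp only: image_mset_mset_set[OF inj_Inl])
  qed
  \<comment> \<open>A block meets \<open>g0\<close> exactly once, so it has one point of weight
    \<open>b\<close> and \<open>v\<close> points of weight \<open>a\<close>.\<close>
  have w_block: "image_mset w (mset_set x) = replicate_mset v a + {#b#}" if x: "x \<in> B" for x
  proof -
    obtain z where z: "z \<in> x" "z \<in> g0" and un: "\<And>y. y \<in> x \<Longrightarrow> y \<in> g0 \<Longrightarrow> y = z"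
      using block_group_transversal[OF gdd groups(1) x g0] by metis
    have "image_mset w (mset_set (x - {z})) = image_mset (\<lambda>_. a) (mset_set (x - {z}))"
      using un fin_block[OF x] by (intro image_mset_cong) (auto simp: w_def)
    also have "\<dots> = replicate_mset v a"
      using z blocks(2)[OF x] fin_block[OF x] by (simp add: image_mset_const_eq)
    finally show ?thesis
      using z(2) mset_set.remove[OF fin_block[OF x] z(1)] by (simp add: w_def)
  qed

  have "GDD_exists 4 (image_mset (\<lambda>i. \<Sum>p | p \<in> Q \<and> lab p = i. wt p) (mset_set (lab ` Q)))"
  proof (rule wilson_fundamental_construction)
    show "finite Q" using finV T by (simp add: Q_def)
    show "S \<noteq> {}" using glI g0 by blast
    show "L \<subseteq> Q" if "L \<in> S" for L
      using SE[OF that]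
    proof (elim disjE bexE conjE)
      fix g assume "g \<in> G" "L = gl g"
      then show ?thesis using GV unfolding gl_def Q_def by blast
    next
      fix C x assume "C \<in> P" "x \<in> C" "L = bl C x"
      then show ?thesis using blocks(1)[of x] PBD[of x C] unfolding bl_def Q_def by blast
    qed
  next
    fix p q assume pq: "p \<in> Q" "q \<in> Q" "lab p \<noteq> lab q"
    then show "\<exists>!L. L \<in> S \<and> p \<in> L \<and> q \<in> L"
    proof (cases p; cases q)
      fix x y assume "p = Inl x" "q = Inl y"
      then show ?thesis using LL[of x y] pq by (auto simp only: Q_def)
    next
      fix x C assume "p = Inl x" "q = Inr C"
      then show ?thesis using LR[of x C] pq by (auto simp only: Q_def)
    next
      fix x C assume "p = Inr C" "q = Inl x"
      then show ?thesis using LR[of x C] pq by (auto simp only: Q_def)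
    next
      \<comment> \<open>All infinite points share the label \<open>{}\<close>, so no such pair has
        to be joined.\<close>
      fix C D assume "p = Inr C" "q = Inr D"
      then show ?thesis using pq labR by simp
    qed
  next
    fix L assume L: "L \<in> S"
    \<comment> \<open>A set is transversal to the new groups if it has at most one infinite point
      and at most one point in each block of \<open>C0\<close>.\<close>
    have inj_Un: "inj_on lab (Inl ` X \<union> Inr ` Y)"
      if X: "X \<subseteq> V" and Y: "\<And>C D. C \<in> Y \<Longrightarrow> D \<in> Y \<Longrightarrow> C = D"
        and XX: "\<And>p q x. p \<in> X \<Longrightarrow> q \<in> X \<Longrightarrow> x \<in> C0 \<Longrightarrow> p \<in> x \<Longrightarrow> q \<in> x \<Longrightarrow> p = q" for X Y
    proof (rule inj_onI)
      fix p q assume pq: "p \<in> Inl ` X \<union> Inr ` Y" "q \<in> Inl ` X \<union> Inr ` Y" "lab p = lab q"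
      have ne: "lab (Inl x) \<noteq> {}" if "x \<in> X" for x using labL(2)[of x] that X by blast
      show "p = q"
      proof (cases p; cases q)
        fix x y assume xy: "p = Inl x" "q = Inl y"
        then have "x \<in> X" "y \<in> X" using pq by auto
        then have "x = y" using XX[of x y "lab (Inl x)"] labL X pq(3) xy by auto
        then show ?thesis using xy by simp
      next
        fix x C assume xC: "p = Inl x" "q = Inr C"
        then have "x \<in> X" using pq(1) by auto
        then show ?thesis using ne[of x] labR pq(3) xC by simp
      next
        fix C x assume xC: "p = Inr C" "q = Inl x"
        then have "x \<in> X" using pq(2) by auto
        then show ?thesis using ne[of x] labR[of C] pq(3) xC by simp
      next
        fix C D assume CD: "p = Inr C" "q = Inr D"
        then have "C \<in> Y" "D \<in> Y" using pq(1,2) by auto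
        then show ?thesis using Y[of C D] CD by simp
      qed
    qed
    show "inj_on lab L" using SE[OF L]
    proof (elim disjE bexE conjE)
      fix g assume g: "g \<in> G" "L = gl g"
      have "L = Inl ` g \<union> Inr ` {C0}" using g by (auto simp: gl_def)
      moreover have "inj_on lab (Inl ` g \<union> Inr ` {C0})"
        by (rule inj_Un) (use g GV same C0B in auto)
      ultimately show ?thesis by simp
    next
      fix C x assume C: "C \<in> P" "x \<in> C" "C \<noteq> C0" "L = bl C x"
      \<comment> \<open>Two common points would make \<open>x\<close> equal to a block of
        \<open>C0\<close>, against the disjointness of the classes.\<close>
      have "p = q" if "p \<in> x" "q \<in> x" "y \<in> C0" "p \<in> y" "q \<in> y" for p q y
        using block_unique[of p x q y] that C C0B PBD class_unique[OF C(1) C0] by blast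
      then have "inj_on lab (Inl ` x \<union> Inr ` ({C} \<inter> T))"
        by (intro inj_Un) (use blocks(1)[OF PBD[OF C(2,1)]] in auto)
      then show ?thesis using C by (simp add: bl_def)
    qed
  next
    fix L assume L: "L \<in> S"
    show "GDD_exists 4 (image_mset wt (mset_set L))" using SE[OF L]
    proof (elim disjE bexE conjE)
      fix g assume g: "g \<in> G" "L = gl g"
      have fing: "finite g" using GV finV g by (meson Union_upper finite_subset)
      have "image_mset w (mset_set g) = image_mset (\<lambda>_. if g = g0 then b else a) (mset_set g)"
        using is_GDD_group_unique[OF gdd g(1) g0] fing
        by (intro image_mset_cong) (auto simp: w_def)
      \<comment> \<open>An extended group has \<open>u\<close> points of one weight,
        \<open>b\<close> for \<open>g0\<close> and \<open>a\<close> otherwise, together with the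
        point of weight \<open>d\<close>.\<close>
      then have "image_mset wt (mset_set L) = replicate_mset u (if g = g0 then b else a) + {#d#}"
        using g fing groups(2) wtL[of g]
        by (simp add: gl_def image_iff image_mset_const_eq) (simp add: wt_def)
      then show ?thesis using assms(5,6) by simp
    next
      fix C x assume C: "C \<in> P" "x \<in> C" "C \<noteq> C0" "L = bl C x"
      have x: "x \<in> B" by (rule PBD[OF C(2,1)])
      show ?thesis
      proof (cases "C \<in> T")
        case True
        then have "L = insert (Inr C) (Inl ` x)" using C(4) by (auto simp: bl_def)
        then have L_type: "image_mset wt (mset_set L) = replicate_mset v a + {#b#} + {#c#}"
          using wtL[of x] fin_block[OF x] w_block[OF x] C(3)
          by (simp add: image_iff) (simp add: wt_def)
        show ?thesis
        proof (cases "c = 0")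
          case True
          \<comment> \<open>An infinite point of weight zero contributes no group, so the ingredient
            without \<open>c\<close> serves here.\<close>
          have "type_norm (replicate_mset v a + {#b#} + {#c#}) = type_norm (replicate_mset v a + {#b#})"
            using True by (simp add: type_norm_def)
          then show ?thesis using L_type assms(8) True GDD_exists_cong_norm by metis
        next
          case False
          have "0 < t" using True T(2,3) card_gt_0_iff by blast
          then show ?thesis using L_type assms(7) False by simp
        qed
      next
        case False
        then have "L = Inl ` x" using C(4) by (auto simp: bl_def)
        then have "image_mset wt (mset_set L) = replicate_mset v a + {#b#}"
          using wtL[of x] w_block[OF x] by simp
        \<comment> \<open>The class \<open>C\<close> lies outside both \<open>T\<close> and
          \<open>{C0}\<close>, so \<open>T\<close> cannot exhaust the remaining \<open>u - 1\<close>
          classes; this gives the strict bound under which the ingredient is available.\<close>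
        moreover have "T \<subset> P - {C0}" using T(1) C False by blast
        then have "t < u - 1"
          using T(2) cardP finP C0 psubset_card_mono[of "P - {C0}" T] by simp
        ultimately show ?thesis using assms(8) by simp
      qed
    qed
  qed
  moreover have labQ: "lab ` Q = insert {} C0"
  proof (intro equalityI subsetI)
    fix x assume "x \<in> insert {} C0"
    then consider "x = {}" | "x \<in> C0" by blast
    then show "x \<in> lab ` Q"
    proof cases
      case 1
      then show ?thesis using labR[of C0] unfolding Q_def by blast
    next
      case 2
      then have "x \<noteq> {}" using empty by blast
      then obtain p where p: "p \<in> x" by blast
      then have "Inl p \<in> Q" using blocks(1)[OF C0B[OF 2]] by (auto simp: Q_def)
      then show ?thesis using labeq[OF 2 p] by blast
    qed
  next
    fix x assume "x \<in> lab ` Q"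
    then show "x \<in> insert {} C0" using labL(1) labR unfolding Q_def by fastforce
  qed
  moreover have "(\<Sum>p | p \<in> Q \<and> lab p = x. wt p) = v * a + b" if x: "x \<in> C0" for x
  proof -
    have "{p \<in> Q. lab p = x} = Inl ` x"
    proof (intro equalityI subsetI)
      fix p assume p: "p \<in> {p \<in> Q. lab p = x}"
      have "x \<noteq> {}" using x empty by blast
      then obtain q where q: "p = Inl q" "q \<in> V" using p labR by (auto simp: Q_def)
      then show "p \<in> Inl ` x" using p labL(2)[of q] by blast
    next
      fix p :: "nat + nat set set" assume "p \<in> Inl ` x"
      then show "p \<in> {p \<in> Q. lab p = x}"
        using labeq[OF x] blocks(1)[OF C0B[OF x]] by (auto simp: Q_def)
    qed
    then have "(\<Sum>p | p \<in> Q \<and> lab p = x. wt p) = sum_mset (image_mset w (mset_set x))"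
      using wtL[of x] by (simp add: sum_unfold_sum_mset)
    then show ?thesis using w_block[OF C0B[OF x]] by simp
  qed
  moreover have "(\<Sum>p | p \<in> Q \<and> lab p = {}. wt p) = c * t + d"
  proof -
    have "lab (Inl p) \<noteq> {}" if "p \<in> V" for p using labL(2)[OF that] by blast
    \<comment> \<open>The last new group consists of the infinite points alone: one of weight
      \<open>d\<close> and \<open>t\<close> of weight \<open>c\<close>.\<close>
    then have "{p \<in> Q. lab p = {}} = Inr ` insert C0 T" using labR by (auto simp: Q_def)
    moreover have "C0 \<notin> T" using T by blast
    ultimately have "(\<Sum>p | p \<in> Q \<and> lab p = {}. wt p) = d + (\<Sum>C\<in>T. if C = C0 then d else c)"
      using T(3) by (simp add: sum.reindex wt_def image_iff)
    also have "(\<Sum>C\<in>T. if C = C0 then d else c) = (\<Sum>C\<in>T. c)"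
      using T by (intro sum.cong) auto
    finally show ?thesis using T(2) by simp
  qed
  moreover have "finite C0" using card_class[OF C0] u by (simp add: card_ge_0_finite)
  moreover have "image_mset (\<lambda>x. \<Sum>p | p \<in> Q \<and> lab p = x. wt p) (mset_set C0) =
      image_mset (\<lambda>_. v * a + b) (mset_set C0)"
    using calculation by (intro image_mset_cong) simp
  ultimately show ?thesis
    using empty card_class[OF C0] by (simp add: image_mset_const_eq)
qed

end
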